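(* Let $d,\beta\in\mathbb N$ and $L_0,\dots,L_\beta>0$. Let $f\colon\mathbb R^d\to\mathbb R^d$ be $\beta$-times continuously differentiable with $\sup_{x\in\mathbb R^d}\|D^kf(x)\|_{\mathsf{op}}\le L_k$ for all $k\in\{0,\dots,\beta\}$. Let $x_0\in\mathbb R^d$ and let $u\colon\mathbb R\to\mathbb R^d$ be the solution of $\dot u(t)=f(u(t))$, $u(0)=x_0$. Set $L:=\sup_{k=0,\dots,\beta}L_k$. Then, for all $k\in\{1,\dots,\beta+1\}$, $$\sup_{t\in\mathbb R}\|D^ku(t)\|_2\le(k-1)!\,L^k .$$
   Context: $D^kf(x)$ is the $k$-th derivative of $f$ at $x$ viewed as a symmetric $k$-multilinear map, with $D^0f=f$, and $\|D^kf(x)\|_{\mathsf{op}}:=\sup\{\|D^kf(x)[v_1,\dots,v_k]\|_2:\|v_1\|_2=\dots=\|v_k\|_2=1\}$ (for $k=0$ this is $\|f(x)\|_2$). $D^ku$ is the $k$-th derivative of $u$ in time. *)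

theory Defs
  imports "HOL-Analysis.Analysis"
begin

(* The k-th derivative at x is represented as a map on argument lists of length k:
   nth_frechet f [v1,...,vk] x is D^k f(x)[v1,...,vk].  The recursion is D^k f = D(D^(k-1) f),
   where v1 is the direction in which D^(k-1) f is differentiated.  *)
primrec nth_frechet ::
  "('a::euclidean_space \<Rightarrow> 'b::euclidean_space) \<Rightarrow> 'a list \<Rightarrow> 'a \<Rightarrow> 'b" where
  "nth_frechet f [] = f"
| "nth_frechet f (v # vs) = (\<lambda>x. frechet_derivative (nth_frechet f vs) (at x) v)"

abbreviation Dk ::
  "('a::euclidean_space \<Rightarrow> 'b::euclidean_space) \<Rightarrow> 'a \<Rightarrow> 'a list \<Rightarrow> 'b" where
  "Dk f x vs \<equiv> nth_frechet f vs x"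

(* The spaces are finite-dimensional, so a map into the multilinear maps is Frechet differentiable
   (continuous) in norm iff all its evaluations at fixed arguments are.  Differentiability of the
   derivatives of order < k gives continuity of those orders. *)
definition times_continuously_differentiable ::
  "nat \<Rightarrow> ('a::euclidean_space \<Rightarrow> 'b::euclidean_space) \<Rightarrow> bool" where
  "times_continuously_differentiable k f \<longleftrightarrow>
     (\<forall>vs x. length vs < k \<longrightarrow> (\<lambda>y. Dk f y vs) differentiable (at x)) \<and>
     (\<forall>vs. length vs = k \<longrightarrow> continuous_on UNIV (\<lambda>y. Dk f y vs))"

(* Extended-real valued, since Sup on the reals is unspecified for unbounded sets.
   For k = 0 the only argument list is [], and the value is norm (T []). *)
definition multilinear_op_norm ::
  "nat \<Rightarrow> ('a::euclidean_space list \<Rightarrow> 'b::euclidean_space) \<Rightarrow> ereal" where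
  "multilinear_op_norm k T =
     (SUP vs \<in> {vs. length vs = k \<and> (\<forall>v \<in> set vs. norm v = 1)}. ereal (norm (T vs)))"

definition time_deriv ::
  "nat \<Rightarrow> (real \<Rightarrow> 'b::euclidean_space) \<Rightarrow> real \<Rightarrow> 'b" where
  "time_deriv k u = ((\<lambda>g t. vector_derivative g (at t)) ^^ k) u"

end

(* Differentiating u' = f(u) repeatedly writes D^k u as a sum of elementary differentials, one for
   each increasing rooted tree with k vertices: a vertex with j children stands for D^j f(u) applied
   to the children, and by the product and chain rules the time derivative of a tree is the sum of
   the k trees obtained by attaching a new leaf to one of its vertices.  Hence there are (k - 1)!
   summands in D^k u, and each has norm at most L^k since every vertex contributes a factor L.  *)
theory Submission
  imports Defs
begin

section \<open>Iterated Frechet derivatives\<close>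

lemma nth_frechet_differentiable:
  assumes "times_continuously_differentiable n f" "length vs < n"
  shows "nth_frechet f vs differentiable (at x)"
  using assms by (simp add: times_continuously_differentiable_def)

text \<open>For the head slot this is linearity of a Frechet derivative. For a later slot,
  additivity and homogeneity hold at every base point, so they are identities between functions of
  that point and survive differentiation in the directions that precede.\<close>

lemma linear_nth_frechet_arg:
  assumes "times_continuously_differentiable n f" "length vs + length ws < n"
  shows "linear (\<lambda>v. nth_frechet f (vs @ v # ws) x)"
  using assms(2)
proof (induction vs arbitrary: x)
  case Nil
  then have "nth_frechet f ws differentiable (at x)"
    using nth_frechet_differentiable[OF assms(1)] by simp
  then show ?case
    by (simp add: linear_frechet_derivative)
next
  case (Cons a vs)
  then have lin: "linear (\<lambda>v. nth_frechet f (vs @ v # ws) y)" for y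
    by simp
  have diff: "nth_frechet f (vs @ v # ws) differentiable (at x)" for v
    using nth_frechet_differentiable[OF assms(1)] Cons.prems by simp
  show ?case
  proof (rule linearI)
    fix v w
    have "nth_frechet f (vs @ (v + w) # ws) =
        (\<lambda>y. nth_frechet f (vs @ v # ws) y + nth_frechet f (vs @ w # ws) y)"
      using linear_add[OF lin] by auto
    moreover have "((\<lambda>y. nth_frechet f (vs @ v # ws) y + nth_frechet f (vs @ w # ws) y) has_derivative
        (\<lambda>h. frechet_derivative (nth_frechet f (vs @ v # ws)) (at x) h +
          frechet_derivative (nth_frechet f (vs @ w # ws)) (at x) h)) (at x)"
      using diff[of v] diff[of w] by (intro derivative_intros) (simp_all add: frechet_derivative_works)
    ultimately show "nth_frechet f ((a # vs) @ (v + w) # ws) x =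
        nth_frechet f ((a # vs) @ v # ws) x + nth_frechet f ((a # vs) @ w # ws) x"
      by (simp add: frechet_derivative_at[symmetric])
  next
    fix c v
    have "nth_frechet f (vs @ (c *\<^sub>R v) # ws) = (\<lambda>y. c *\<^sub>R nth_frechet f (vs @ v # ws) y)"
      using linear_scale[OF lin] by auto
    moreover have "((\<lambda>y. c *\<^sub>R nth_frechet f (vs @ v # ws) y) has_derivative
        (\<lambda>h. c *\<^sub>R frechet_derivative (nth_frechet f (vs @ v # ws)) (at x) h)) (at x)"
      using diff[of v] by (intro derivative_intros) (simp add: frechet_derivative_works)
    ultimately show "nth_frechet f ((a # vs) @ (c *\<^sub>R v) # ws) x =
        c *\<^sub>R nth_frechet f ((a # vs) @ v # ws) x"
      by (simp add: frechet_derivative_at[symmetric])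
  qed
qed

lemma nth_frechet_arg_sum_list:
  assumes "times_continuously_differentiable n f" "length vs + length ws < n"
  shows "nth_frechet f (vs @ sum_list ys # ws) x = (\<Sum>y\<leftarrow>ys. nth_frechet f (vs @ y # ws) x)"
proof (induction ys)
  case Nil
  show ?case
    using linear_0[OF linear_nth_frechet_arg[OF assms]] by simp
next
  case (Cons y ys)
  then show ?case
    using linear_add[OF linear_nth_frechet_arg[OF assms]] by simp
qed

text \<open>Separates a moving argument from the base point: only scalar coefficients depend on
  \<open>v\<close>, and the remaining derivatives are taken along constant directions.\<close>

lemma nth_frechet_arg_Basis:
  assumes "times_continuously_differentiable n f" "length vs + length ws < n"
  shows "nth_frechet f (vs @ v # ws) x = (\<Sum>b\<in>Basis. (v \<bullet> b) *\<^sub>R nth_frechet f (vs @ b # ws) x)"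
proof -
  note lin = linear_nth_frechet_arg[OF assms]
  have "nth_frechet f (vs @ v # ws) x = nth_frechet f (vs @ (\<Sum>b\<in>Basis. (v \<bullet> b) *\<^sub>R b) # ws) x"
    by (simp add: euclidean_representation)
  then show ?thesis
    by (simp add: linear_sum[OF lin] linear_scale[OF lin])
qed

text \<open>Homogeneity in each slot. The prefix \<open>us\<close> collects arguments already
  normalised, so the induction on \<open>vs\<close> ends at a list of unit vectors, where the bound
  \<open>M\<close> applies.\<close>

lemma norm_nth_frechet_le_append:
  assumes "times_continuously_differentiable n f"
    and "\<And>us. length us = m \<Longrightarrow> \<forall>u\<in>set us. norm u = 1 \<Longrightarrow> norm (nth_frechet f us x) \<le> M"
    and "length us + length vs = m" "m \<le> n" "\<forall>u\<in>set us. norm u = 1"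
  shows "norm (nth_frechet f (us @ vs) x) \<le> M * prod_list (map norm vs)"
  using assms(3,5)
proof (induction vs arbitrary: us)
  case Nil
  then show ?case using assms(2) by simp
next
  case (Cons v vs)
  then have lin: "linear (\<lambda>v. nth_frechet f (us @ v # vs) x)"
    using assms(4) by (intro linear_nth_frechet_arg[OF assms(1)]) simp
  show ?case
  \<comment> \<open>\<open>sgn 0\<close> is \<open>0\<close> and not a unit vector, so this case
    relies on linearity alone.\<close>
  proof (cases "v = 0")
    case True
    then show ?thesis using linear_0[OF lin] by simp
  next
    case False
    have "norm (nth_frechet f ((us @ [sgn v]) @ vs) x) \<le> M * prod_list (map norm vs)"
      using Cons.prems False by (intro Cons.IH) (auto simp: norm_sgn)
    moreover have "v = norm v *\<^sub>R sgn v"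
      using False by (simp add: sgn_div_norm)
    then have "nth_frechet f (us @ v # vs) x = norm v *\<^sub>R nth_frechet f (us @ sgn v # vs) x"
      by (metis linear_scale[OF lin])
    ultimately show ?thesis
      by (simp add: mult.left_commute[of M] mult_left_mono)
  qed
qed

lemma norm_nth_frechet_le:
  assumes "times_continuously_differentiable n f" "length vs \<le> n"
    and "multilinear_op_norm (length vs) (Dk f x) \<le> ereal M"
  shows "norm (nth_frechet f vs x) \<le> M * prod_list (map norm vs)"
proof -
  have "norm (nth_frechet f us x) \<le> M" if "length us = length vs" "\<forall>u\<in>set us. norm u = 1" for us
    using assms(3) that unfolding multilinear_op_norm_def by (simp add: SUP_le_iff)
  from norm_nth_frechet_le_append[OF assms(1) this, where us = "[]" and vs = vs] show ?thesis
    using assms(2) by simp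
qed

section \<open>Elementary differentials\<close>

datatype rtree = Vertex "rtree list"

fun vertices :: "rtree \<Rightarrow> nat" where
  "vertices (Vertex ts) = Suc (\<Sum>t\<leftarrow>ts. vertices t)"

text \<open>Children are ordered to match argument lists. A leaf attached to the root goes in front
  because \<open>nth_frechet\<close> takes the newest direction as its head;
  \<open>grow_forest\<close> covers the vertices below the root.\<close>

fun grow :: "rtree \<Rightarrow> rtree list" and grow_forest :: "rtree list \<Rightarrow> rtree list list" where
  "grow (Vertex ts) = Vertex (Vertex [] # ts) # map Vertex (grow_forest ts)"
| "grow_forest [] = []"
| "grow_forest (t # ts) = map (\<lambda>s. s # ts) (grow t) @ map ((#) t) (grow_forest ts)"

fun elem_diff :: "('a::euclidean_space \<Rightarrow> 'a) \<Rightarrow> 'a \<Rightarrow> rtree \<Rightarrow> 'a" where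
  "elem_diff f x (Vertex ts) = nth_frechet f (map (elem_diff f x) ts) x"

text \<open>Each vertex is the parent of the new leaf in exactly one grown tree; this produces the
  factorial later.\<close>

lemma length_grow:
  "length (grow t) = vertices t"
  "length (grow_forest ts) = (\<Sum>t\<leftarrow>ts. vertices t)"
  by (induction t and ts rule: grow_grow_forest.induct) auto

lemma vertices_grow:
  "\<forall>s\<in>set (grow t). vertices s = Suc (vertices t)"
  "\<forall>ss\<in>set (grow_forest ts). (\<Sum>s\<leftarrow>ss. vertices s) = Suc (\<Sum>t\<leftarrow>ts. vertices t)"
  by (induction t and ts rule: grow_grow_forest.induct) auto

lemma sum_scaleR_sum_list:
  fixes g :: "'b \<Rightarrow> 'c \<Rightarrow> 'a::real_vector"
  shows "(\<Sum>b\<in>B. c b *\<^sub>R (\<Sum>x\<leftarrow>xs. g b x)) = (\<Sum>x\<leftarrow>xs. \<Sum>b\<in>B. c b *\<^sub>R g b x)"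
  by (induction xs) (simp_all add: scaleR_add_right sum.distrib)

lemma vertices_pos: "vertices t > 0"
  by (cases t) simp

lemma length_le_sum_vertices: "length ts \<le> (\<Sum>t\<leftarrow>ts. vertices t)"
proof (induction ts)
  case (Cons t ts)
  then show ?case using vertices_pos[of t] by simp
qed simp

text \<open>In the forest version the constant arguments \<open>vs\<close> leave room to fix the leading arguments of
  the multilinear map one at a time, after expanding them in a basis.\<close>
lemma elem_diff_has_vector_derivative_aux:
  fixes f :: "'a::euclidean_space \<Rightarrow> 'a"
  assumes f: "times_continuously_differentiable n f"
    and u: "(u has_vector_derivative f (u \<tau>)) (at \<tau>)"
  shows "vertices t \<le> n \<Longrightarrow>
      ((\<lambda>\<tau>. elem_diff f (u \<tau>) t) has_vector_derivative
        (\<Sum>s\<leftarrow>grow t. elem_diff f (u \<tau>) s)) (at \<tau>)"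
    and "length vs + (\<Sum>t\<leftarrow>ts. vertices t) < n \<Longrightarrow>
      ((\<lambda>\<tau>. nth_frechet f (vs @ map (elem_diff f (u \<tau>)) ts) (u \<tau>)) has_vector_derivative
        nth_frechet f (f (u \<tau>) # vs @ map (elem_diff f (u \<tau>)) ts) (u \<tau>) +
        (\<Sum>ss\<leftarrow>grow_forest ts. nth_frechet f (vs @ map (elem_diff f (u \<tau>)) ss) (u \<tau>))) (at \<tau>)"
proof (induction t and ts arbitrary: and vs rule: grow_grow_forest.induct)
  case (1 ts)
  \<comment> \<open>With the empty prefix, the term headed by \<open>f (u \<tau>)\<close> is the
    tree with a new leaf at the root, since a leaf evaluates to \<open>f (u \<tau>)\<close>.\<close>
  then show ?case
    using "1.IH"[of "[]"] by (simp add: o_def)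
next
  case (2 vs)
  \<comment> \<open>All arguments are constant here, so only the base point moves and the plain
    chain rule applies.\<close>
  then have "(nth_frechet f vs has_derivative frechet_derivative (nth_frechet f vs) (at (u \<tau>)))
      (at (u \<tau>))"
    using nth_frechet_differentiable[OF f] by (simp add: frechet_derivative_works)
  then have "(nth_frechet f vs \<circ> u has_vector_derivative
      frechet_derivative (nth_frechet f vs) (at (u \<tau>)) (f (u \<tau>))) (at \<tau>)"
    using u vector_derivative_diff_chain_within has_derivative_at_withinI by blast
  then show ?case
    by (simp add: o_def)
next
  case (3 t ts vs)
  define E where "E = (\<lambda>\<tau>. elem_diff f (u \<tau>))"
  have len: "length vs + length ts < n" "length (f (u \<tau>) # vs) + length ts < n"
    using "3.prems" length_le_sum_vertices[of ts] vertices_pos[of t] by auto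
  have expand: "nth_frechet f (vs @ v # map (E \<tau>) ts) x =
      (\<Sum>b\<in>Basis. (v \<bullet> b) *\<^sub>R nth_frechet f (vs @ b # map (E \<tau>) ts) x)" for v \<tau> x
    using len(1) by (intro nth_frechet_arg_Basis[OF f]) simp
  define G where
    "G = (\<lambda>b \<tau>. nth_frechet f (vs @ b # map (E \<tau>) ts) (u \<tau>))"
  define G' where
    "G' = (\<lambda>b. nth_frechet f (f (u \<tau>) # vs @ b # map (E \<tau>) ts) (u \<tau>) +
        (\<Sum>ss\<leftarrow>grow_forest ts. nth_frechet f (vs @ b # map (E \<tau>) ss) (u \<tau>)))"
  \<comment> \<open>The basis vector \<open>b\<close> joins the constant prefix. The tree
    \<open>t\<close> leaves the forest and has at least one vertex, which pays for the longer prefix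
    in the bound by \<open>n\<close>.\<close>
  have G: "(G b has_vector_derivative G' b) (at \<tau>)" for b
    using "3.IH"(2)[of "vs @ [b]"] "3.prems" vertices_pos[of t] by (simp add: G_def G'_def E_def)
  have E: "((\<lambda>\<tau>. E \<tau> t) has_vector_derivative (\<Sum>s\<leftarrow>grow t. E \<tau> s)) (at \<tau>)"
    using "3.IH"(1) "3.prems" by (simp add: E_def)
  let ?e' = "\<Sum>s\<leftarrow>grow t. E \<tau> s"
  \<comment> \<open>Product rule, coefficient times \<open>G b\<close>. The terms with
    \<open>?e'\<close> grow \<open>t\<close>; those with \<open>G' b\<close> differentiate the base
    point or grow a later tree.\<close>
  have "((\<lambda>\<tau>. \<Sum>b\<in>Basis. (E \<tau> t \<bullet> b) *\<^sub>R G b \<tau>) has_vector_derivative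
      (\<Sum>b\<in>Basis. (E \<tau> t \<bullet> b) *\<^sub>R G' b + (?e' \<bullet> b) *\<^sub>R G b \<tau>)) (at \<tau>)"
  proof (intro has_vector_derivative_sum has_vector_derivative_scaleR G)
    fix b :: 'a
    show "((\<lambda>\<tau>. E \<tau> t \<bullet> b) has_real_derivative ?e' \<bullet> b) (at \<tau>)"
      unfolding has_real_derivative_iff_has_vector_derivative
      by (rule bounded_linear.has_vector_derivative[OF bounded_linear_inner_left E])
  qed
  moreover have "(\<Sum>b\<in>Basis. (E \<tau> t \<bullet> b) *\<^sub>R G b \<tau>) = nth_frechet f (vs @ E \<tau> t # map (E \<tau>) ts) (u \<tau>)"
    for \<tau>
    unfolding G_def by (rule expand[symmetric])
  moreover have "(\<Sum>b\<in>Basis. (?e' \<bullet> b) *\<^sub>R G b \<tau>) =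
      (\<Sum>s\<leftarrow>grow t. nth_frechet f (vs @ E \<tau> s # map (E \<tau>) ts) (u \<tau>))"
    using nth_frechet_arg_sum_list[OF f, of vs "map (E \<tau>) ts" "map (E \<tau>) (grow t)"] len(1)
    unfolding G_def by (simp add: expand[symmetric] o_def)
  moreover have "(\<Sum>b\<in>Basis. (E \<tau> t \<bullet> b) *\<^sub>R G' b) =
      nth_frechet f (f (u \<tau>) # vs @ E \<tau> t # map (E \<tau>) ts) (u \<tau>) +
      (\<Sum>ss\<leftarrow>grow_forest ts. nth_frechet f (vs @ E \<tau> t # map (E \<tau>) ss) (u \<tau>))"
  proof -
    have "(\<Sum>b\<in>Basis. (E \<tau> t \<bullet> b) *\<^sub>R nth_frechet f (vs @ b # map (E \<tau>) ss) (u \<tau>)) =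
        nth_frechet f (vs @ E \<tau> t # map (E \<tau>) ss) (u \<tau>)" if "ss \<in> set (grow_forest ts)" for ss
    proof -
      \<comment> \<open>\<open>ss\<close> has one vertex more than \<open>ts\<close>, which is
        covered by the at least one vertex of \<open>t\<close>.\<close>
      have "length vs + length ss < n"
        using that vertices_grow(2)[of ts] length_le_sum_vertices[of ss] "3.prems"
          vertices_pos[of t] by auto
      then show ?thesis
        by (intro nth_frechet_arg_Basis[OF f, symmetric]) simp
    qed
    then have "(\<Sum>ss\<leftarrow>grow_forest ts. nth_frechet f (vs @ E \<tau> t # map (E \<tau>) ss) (u \<tau>)) =
        (\<Sum>ss\<leftarrow>grow_forest ts.
          \<Sum>b\<in>Basis. (E \<tau> t \<bullet> b) *\<^sub>R nth_frechet f (vs @ b # map (E \<tau>) ss) (u \<tau>))"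
      by (intro arg_cong[where f = sum_list] map_cong) auto
    also have "\<dots> = (\<Sum>b\<in>Basis. (E \<tau> t \<bullet> b) *\<^sub>R
          (\<Sum>ss\<leftarrow>grow_forest ts. nth_frechet f (vs @ b # map (E \<tau>) ss) (u \<tau>)))"
      by (rule sum_scaleR_sum_list[symmetric])
    finally show ?thesis
      using nth_frechet_arg_Basis[OF f, of "f (u \<tau>) # vs" "map (E \<tau>) ts" "E \<tau> t"] len(2)
      by (simp add: G'_def scaleR_add_right sum.distrib)
  qed
  ultimately show ?case
    by (simp add: E_def sum.distrib o_def algebra_simps)
qed

lemmas elem_diff_has_vector_derivative = elem_diff_has_vector_derivative_aux(1)

text \<open>Every vertex contributes one factor \<open>M\<close>. A vertex of a tree with at most
  \<open>Suc n\<close> vertices has at most \<open>n\<close> children, so only derivatives of order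
  up to \<open>n\<close> occur.\<close>

lemma norm_elem_diff_le:
  fixes f :: "'a::euclidean_space \<Rightarrow> 'a"
  assumes f: "times_continuously_differentiable n f"
    and M: "\<And>k. k \<le> n \<Longrightarrow> multilinear_op_norm k (Dk f x) \<le> ereal M" "M \<ge> 0"
  shows "vertices t \<le> Suc n \<Longrightarrow> norm (elem_diff f x t) \<le> M ^ vertices t"
proof (induction t)
  case (Vertex ts)
  then have sum: "(\<Sum>t\<leftarrow>ts. vertices t) \<le> n"
    by simp
  then have len: "length ts \<le> n"
    using length_le_sum_vertices[of ts] by simp
  have prod: "prod_list (map (\<lambda>t. norm (elem_diff f x t)) ts) \<le> M ^ (\<Sum>t\<leftarrow>ts. vertices t)"
    using sum Vertex.IH
  proof (induction ts)
    case (Cons t ts)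
    then have "norm (elem_diff f x t) \<le> M ^ vertices t"
      "prod_list (map (\<lambda>t. norm (elem_diff f x t)) ts) \<le> M ^ (\<Sum>t\<leftarrow>ts. vertices t)"
      by auto
    then show ?case
      using M(2) by (auto simp: power_add intro!: mult_mono prod_list_nonneg)
  qed simp
  have "norm (elem_diff f x (Vertex ts)) \<le> M * prod_list (map (\<lambda>t. norm (elem_diff f x t)) ts)"
    using norm_nth_frechet_le[OF f, of "map (elem_diff f x) ts" x M] len M(1)
    by (simp add: o_def)
  also have "\<dots> \<le> M * M ^ (\<Sum>t\<leftarrow>ts. vertices t)"
    using prod M(2) by (rule mult_left_mono)
  finally show ?case
    by simp
qed

section \<open>Increasing trees and their number\<close>

text \<open>Index \<open>n\<close> stands for \<open>Suc n\<close> vertices; a shape is repeated once per increasing labelling.\<close>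
primrec increasing_trees :: "nat \<Rightarrow> rtree list" where
  "increasing_trees 0 = [Vertex []]"
| "increasing_trees (Suc n) = concat (map grow (increasing_trees n))"

lemma vertices_increasing_trees: "t \<in> set (increasing_trees n) \<Longrightarrow> vertices t = Suc n"
  by (induction n arbitrary: t) (auto dest: vertices_grow(1)[rule_format])

text \<open>Each tree at index \<open>n\<close> has \<open>Suc n\<close> vertices and hence
  \<open>Suc n\<close> grown trees, which gives the recursion of the factorial.\<close>

lemma length_increasing_trees: "length (increasing_trees n) = fact n"
proof (induction n)
  case (Suc n)
  have "length (increasing_trees (Suc n)) = (\<Sum>t\<leftarrow>increasing_trees n. vertices t)"
    by (simp add: length_concat o_def length_grow(1))
  also have "\<dots> = (\<Sum>t\<leftarrow>increasing_trees n. Suc n)"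
    by (intro arg_cong[where f = sum_list] map_cong) (auto simp: vertices_increasing_trees)
  finally show ?case
    using Suc by (simp add: sum_list_triv)
qed simp

section \<open>Time derivatives of the solution as sums over increasing trees\<close>

lemma sum_list_concat_map: "sum_list (map h (concat (map g xs))) = (\<Sum>x\<leftarrow>xs. \<Sum>y\<leftarrow>g x. h y)"
  by (induction xs) auto

lemma has_vector_derivative_sum_list:
  "(\<And>x. x \<in> set xs \<Longrightarrow> (g x has_vector_derivative g' x) F) \<Longrightarrow>
    ((\<lambda>t. \<Sum>x\<leftarrow>xs. g x t) has_vector_derivative (\<Sum>x\<leftarrow>xs. g' x)) F"
  by (induction xs) (auto intro!: derivative_eq_intros)

text \<open>The bound \<open>k < n\<close> says that the trees at index \<open>k\<close>, with
  \<open>Suc k\<close> vertices, have at most \<open>n\<close> vertices and can still be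
  differentiated.\<close>

lemma increasing_trees_has_vector_derivative:
  assumes "times_continuously_differentiable n f" "k < n"
    and "(u has_vector_derivative f (u \<tau>)) (at \<tau>)"
  shows "((\<lambda>\<tau>. \<Sum>t\<leftarrow>increasing_trees k. elem_diff f (u \<tau>) t) has_vector_derivative
      (\<Sum>t\<leftarrow>increasing_trees (Suc k). elem_diff f (u \<tau>) t)) (at \<tau>)"
  using assms
  by (auto simp: sum_list_concat_map vertices_increasing_trees
      intro!: has_vector_derivative_sum_list elem_diff_has_vector_derivative)

lemma time_deriv_Suc_eq_increasing_trees:
  assumes f: "times_continuously_differentiable n f"
    and u: "\<And>\<tau>. (u has_vector_derivative f (u \<tau>)) (at \<tau>)"
  shows "k \<le> n \<Longrightarrow> time_deriv (Suc k) u \<tau> = (\<Sum>t\<leftarrow>increasing_trees k. elem_diff f (u \<tau>) t)"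
proof (induction k arbitrary: \<tau>)
  case 0
  show ?case
    using vector_derivative_at[OF u] by (simp add: time_deriv_def)
next
  case (Suc k)
  \<comment> \<open>The induction hypothesis holds at all times, so it is an equality of functions
    and may be differentiated.\<close>
  then have "time_deriv (Suc k) u = (\<lambda>\<tau>. \<Sum>t\<leftarrow>increasing_trees k. elem_diff f (u \<tau>) t)"
    by auto
  then have "(time_deriv (Suc k) u has_vector_derivative
      (\<Sum>t\<leftarrow>increasing_trees (Suc k). elem_diff f (u \<tau>) t)) (at \<tau>)"
    using increasing_trees_has_vector_derivative[OF f _ u] Suc.prems by simp
  then show ?case
    using vector_derivative_at by (simp add: time_deriv_def)
qed

text \<open>\<open>vector_derivative\<close> returns an arbitrary value where no derivative exists;
  this ensures that the iterates in the final bound are genuine derivatives.\<close>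

lemma time_deriv_differentiable:
  assumes f: "times_continuously_differentiable n f"
    and u: "\<And>\<tau>. (u has_vector_derivative f (u \<tau>)) (at \<tau>)"
    and "k \<le> n"
  shows "time_deriv k u differentiable (at \<tau>)"
proof (cases k)
  case 0
  then show ?thesis
    using u by (auto simp: time_deriv_def intro: differentiableI_vector)
next
  case (Suc j)
  then have "time_deriv k u = (\<lambda>\<tau>. \<Sum>t\<leftarrow>increasing_trees j. elem_diff f (u \<tau>) t)"
    using time_deriv_Suc_eq_increasing_trees[OF f u] assms(3) by auto
  then show ?thesis
    using increasing_trees_has_vector_derivative[OF f _ u, of j, THEN differentiableI_vector]
      assms(3) Suc by simp
qed

section \<open>Norm bounds for the time derivatives\<close>

lemma norm_sum_list_le: "norm (\<Sum>x\<leftarrow>xs. g x) \<le> (\<Sum>x\<leftarrow>xs. norm (g x))"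
  by (induction xs) (auto intro: norm_triangle_le)

lemma norm_time_deriv_Suc_le:
  fixes f :: "'a::euclidean_space \<Rightarrow> 'a"
  assumes f: "times_continuously_differentiable n f"
    and u: "\<And>\<tau>. (u has_vector_derivative f (u \<tau>)) (at \<tau>)"
    and M: "\<And>k x. k \<le> n \<Longrightarrow> multilinear_op_norm k (Dk f x) \<le> ereal M" "M \<ge> 0"
    and "k \<le> n"
  shows "norm (time_deriv (Suc k) u \<tau>) \<le> fact k * M ^ Suc k"
proof -
  have "norm (time_deriv (Suc k) u \<tau>) \<le> (\<Sum>t\<leftarrow>increasing_trees k. norm (elem_diff f (u \<tau>) t))"
    unfolding time_deriv_Suc_eq_increasing_trees[OF f u \<open>k \<le> n\<close>]
    by (rule norm_sum_list_le)
  also have "\<dots> \<le> (\<Sum>t\<leftarrow>increasing_trees k. M ^ Suc k)"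
    using norm_elem_diff_le[OF f M] vertices_increasing_trees \<open>k \<le> n\<close>
    by (intro sum_list_mono) (metis Suc_le_mono)
  also have "\<dots> = fact k * M ^ Suc k"
    by (simp only: sum_list_triv length_increasing_trees of_nat_fact)
  finally show ?thesis .
qed

theorem corollaryE7:
  fixes \<beta> :: nat
    and L :: "nat \<Rightarrow> real"
    and Lsup :: real
    and f :: "real ^ 'd \<Rightarrow> real ^ 'd"
    and x0 :: "real ^ 'd"
    and u :: "real \<Rightarrow> real ^ 'd"
  assumes "\<And>k. k \<le> \<beta> \<Longrightarrow> L k > 0"
    and "times_continuously_differentiable \<beta> f"
    and "\<And>k. k \<le> \<beta> \<Longrightarrow> (SUP x. multilinear_op_norm k (Dk f x)) \<le> ereal (L k)"
    and "\<And>t. (u has_vector_derivative f (u t)) (at t)"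
    and "u 0 = x0"
    and "Lsup = (SUP k \<in> {0..\<beta>}. L k)"
  shows "\<forall>k \<in> {1..\<beta> + 1}.
           (\<forall>t. time_deriv (k - 1) u differentiable (at t)) \<and>
           (SUP t. ereal (norm (time_deriv k u t))) \<le> ereal (fact (k - 1) * Lsup ^ k)"
proof -
  \<comment> \<open>A real \<open>SUP\<close> dominates its members only over a set that is bounded
    above; here the index range is finite.\<close>
  have bdd: "bdd_above (L ` {0..\<beta>})"
    by (intro bdd_above_finite) auto
  have L_le: "L k \<le> Lsup" if "k \<le> \<beta>" for k
    unfolding assms(6) using that by (intro cSUP_upper bdd) auto
  have "Lsup \<ge> 0"
    using assms(1)[of 0] L_le[of 0] by linarith
  moreover have "multilinear_op_norm k (Dk f x) \<le> ereal Lsup" if "k \<le> \<beta>" for k x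
  proof -
    have "multilinear_op_norm k (Dk f x) \<le> ereal (L k)"
      using assms(3)[OF that] by (simp add: SUP_le_iff)
    also have "\<dots> \<le> ereal Lsup"
      using L_le[OF that] by simp
    finally show ?thesis .
  qed
  ultimately have bound: "norm (time_deriv (Suc j) u t) \<le> fact j * Lsup ^ Suc j" if "j \<le> \<beta>" for j t
    using norm_time_deriv_Suc_le[OF assms(2,4) _ _ that] by blast
  show ?thesis
  proof (intro ballI conjI allI)
    fix k t
    assume k: "k \<in> {1..\<beta> + 1}"
    then show "time_deriv (k - 1) u differentiable (at t)"
      by (intro time_deriv_differentiable[OF assms(2,4)]) auto
    \<comment> \<open>From \<open>k \<ge> 1\<close>, \<open>Suc (k - 1)\<close> is \<open>k\<close>;
      removing \<open>power_Suc\<close> from the simplifier keeps the power in the form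
      \<open>Lsup ^ k\<close>.\<close>
    show "(SUP t. ereal (norm (time_deriv k u t))) \<le> ereal (fact (k - 1) * Lsup ^ k)"
      using bound[of "k - 1"] k by (intro SUP_least) (auto simp del: power_Suc)
  qed
qed

end
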